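(* Let $n\ge 1$ and let $v\in\mathbb{V}(n)$ correspond to a class whose full parity vector of length $\sigma_n$ starts with exactly $h\geq2$ consecutive ones. Then the canonical representative $x$ of $v$ satisfies $$x\equiv 2^h-1\pmod{2^{h+1}}.$$
   Context: Let $\kappa(n)=\lfloor n\log_2 3\rfloor$ for $n\ge1$ and $\sigma_n=\lfloor 1+(n+1)\log_2 3\rfloor=\kappa(n+1)+1$. For $n\ge1$ let $\mathcal{A}_n$ be the set of integer vectors $\boldsymbol{\alpha}=(\alpha_1,\ldots,\alpha_{n+1})$ with $0=\alpha_1<\cdots<\alpha_{n+1}$ and $\alpha_{i+1}\le\kappa(i)$ for $1\le i\le n$. For $\boldsymbol{\alpha}\in\mathcal{A}_n$ let $v(\boldsymbol{\alpha})\in\{0,1\}^{\kappa(n)+1}$ be the vector (positions indexed $0,\ldots,\kappa(n)$) with ones precisely at positions $\alpha_1,\ldots,\alpha_{n+1}$, and $\mathbb{V}(n)=\{v(\boldsymbol{\alpha}):\boldsymbol{\alpha}\in\mathcal{A}_n\}$. The full parity vector of length $\sigma_n$ associated with $v(\boldsymbol{\alpha})$ is the vector in $\{0,1\}^{\sigma_n}$ with ones precisely at positions $\alpha_1,\ldots,\alpha_{n+1}$. Let $T:\mathbb{Z}\to\mathbb{Z}$ be $T(x)=x/2$ for even $x$ and $T(x)=(3x+1)/2$ for odd $x$. The parity vector of length $L$ of an integer $x$ has entry $1$ at position $s$ ($0\le s\le L-1$) iff $T^s(x)$ is odd; it depends only on $x$ mod $2^L$ and gives a bijection $\mathbb{Z}/2^L\mathbb{Z}\to\{0,1\}^L$.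 The canonical representative of $v(\boldsymbol{\alpha})\in\mathbb{V}(n)$ is the unique $x\in\{1,\ldots,2^{\sigma_n}-1\}$ whose parity vector of length $\sigma_n$ is the full parity vector associated with $v(\boldsymbol{\alpha})$. *)

theory Defs
  imports Complex_Main "HOL-Number_Theory.Cong"
begin

definition kappa :: "nat \<Rightarrow> nat"
  where "kappa n = nat \<lfloor>real n * log 2 3\<rfloor>"

definition sigma :: "nat \<Rightarrow> nat"
  where "sigma n = nat \<lfloor>1 + real (n + 1) * log 2 3\<rfloor>"

text \<open>Lists are indexed from 0, so the entry written \<open>\<alpha>\<^sub>i\<^sub>+\<^sub>1\<close> on paper is \<open>\<alpha> ! i\<close>.\<close>

definition admissible :: "nat \<Rightarrow> int list set"
  where "admissible n =
    {\<alpha>. length \<alpha> = n + 1 \<and> \<alpha> ! 0 = 0 \<and> sorted_wrt (<) \<alpha> \<and>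
        (\<forall>i\<in>{1..n}. \<alpha> ! i \<le> int (kappa i))}"

definition ones_at :: "nat \<Rightarrow> int list \<Rightarrow> nat list"
  where "ones_at L \<alpha> = map (\<lambda>s. of_bool (int s \<in> set \<alpha>)) [0..<L]"

definition vec :: "nat \<Rightarrow> int list \<Rightarrow> nat list"
  where "vec n \<alpha> = ones_at (kappa n + 1) \<alpha>"

definition VV :: "nat \<Rightarrow> nat list set"
  where "VV n = vec n ` admissible n"

text \<open>The description is proper for \<open>v \<in> VV n\<close>: all entries of an admissible \<open>\<alpha>\<close> lie in
  \<open>{0..kappa n}\<close>, so \<open>v\<close> determines \<open>\<alpha>\<close>.\<close>

definition full_parity_vector :: "nat \<Rightarrow> nat list \<Rightarrow> nat list"
  where "full_parity_vector n v =
    (THE w. \<exists>\<alpha>\<in>admissible n. v = vec n \<alpha> \<and> w = ones_at (sigma n) \<alpha>)"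

definition T :: "int \<Rightarrow> int"
  where "T x = (if even x then x div 2 else (3 * x + 1) div 2)"

definition parity_vector :: "nat \<Rightarrow> int \<Rightarrow> nat list"
  where "parity_vector L x = map (\<lambda>s. of_bool (odd ((T ^^ s) x))) [0..<L]"

text \<open>The description is proper for \<open>v \<in> VV n\<close>: parity vectors of length \<open>L\<close> biject with
  residues modulo \<open>2 ^ L\<close>, and residue 0 is excluded because the full parity vector starts
  with a one.\<close>

definition canonical_rep :: "nat \<Rightarrow> nat list \<Rightarrow> int"
  where "canonical_rep n v =
    (THE x. x \<in> {1..2 ^ sigma n - 1} \<and>
            parity_vector (sigma n) x = full_parity_vector n v)"

definition leading_ones :: "nat list \<Rightarrow> nat"
  where "leading_ones w = length (takeWhile (\<lambda>b. b = 1) w)"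

end

theory Submission
  imports Defs
begin

text \<open>
  The integer \<open>-1\<close> is a fixed point of \<open>T\<close>, and it is odd; so its parity vectors consist of ones only.
  Parity vectors of length \<open>L\<close> separate residues modulo \<open>2 ^ L\<close>, hence an integer \<open>x\<close> whose parity
  vector starts with \<open>h\<close> ones is congruent to \<open>-1\<close> modulo \<open>2 ^ h\<close>, say \<open>x = -1 + 2 ^ h * k\<close>.  The
  \<open>h\<close>-th iterate of \<open>T\<close> then takes \<open>x\<close> to \<open>-1 + c * k\<close> with \<open>c\<close> odd
  (\<open>T_iterate_add_power2\<close>).  If the entry at position \<open>h\<close> is zero, this value is even, so \<open>k\<close> is odd,
  which is the congruence \<open>x \<equiv> 2 ^ h - 1\<close> modulo \<open>2 ^ (h + 1)\<close> (\<open>cong_of_leading_odd_iterates\<close>).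

  There is an entry at position \<open>h\<close>, and it is a zero, because the full parity vector of a class in
  \<open>VV n\<close> is the vector of the class followed by at least one zero
  (\<open>full_parity_vector_eq_append_zeros\<close>).  The remaining work is to see that the canonical
  representative has the full parity vector as its parity vector; this rests on the bijection between
  residues modulo \<open>2 ^ L\<close> and parity vectors of length \<open>L\<close>.
\<close>

section \<open>Parity vectors and residues modulo powers of two\<close>

text \<open>On each parity class \<open>T\<close> is affine with slope \<open>1 / 2\<close> or \<open>3 / 2\<close>, so each step consumes one
  factor \<open>2\<close> of the shift and multiplies it by \<open>1\<close> or \<open>3\<close>.  The shift by \<open>2 ^ s * k\<close> does not
  affect the first \<open>s\<close> parities, so \<open>c\<close>, the product of these factors, is the same for all \<open>k\<close>.\<close>

lemma T_iterate_add_power2: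
  "\<exists>c. odd c \<and> (\<forall>k. (T ^^ s) (x + 2 ^ s * k) = (T ^^ s) x + c * k)"
proof (induction s)
  case 0
  show ?case by (intro exI[of _ 1]) simp
next
  case (Suc s)
  then obtain c where c: "odd c" "\<And>k. (T ^^ s) (x + 2 ^ s * k) = (T ^^ s) x + c * k"
    by blast
  define d :: int where "d = (if even ((T ^^ s) x) then 1 else 3)"
  have step: "T (y + 2 * m) = T y + (if even y then 1 else 3) * m" for y m
    by (cases "even y") (auto simp: T_def elim!: evenE oddE)
  have "(T ^^ Suc s) (x + 2 ^ Suc s * k) = (T ^^ Suc s) x + (d * c) * k" for k
    using c(2)[of "2 * k"] step[of "(T ^^ s) x" "c * k"] by (simp add: d_def algebra_simps)
  moreover have "odd (d * c)"
    using c(1) by (simp add: d_def)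
  ultimately show ?case by blast
qed

lemma parity_vector_eq_iff:
  "parity_vector L x = parity_vector L y \<longleftrightarrow> (\<forall>s<L. odd ((T ^^ s) x) \<longleftrightarrow> odd ((T ^^ s) y))"
  by (auto simp: parity_vector_def)

lemma parity_vector_cong:
  assumes "[x = y] (mod 2 ^ L)"
  shows "parity_vector L x = parity_vector L y"
  unfolding parity_vector_eq_iff
proof (intro allI impI)
  fix s assume "s < L"
  from assms obtain k where k: "y = x + 2 ^ L * k"
    by (metis cong_iff_lin mult.commute)
  obtain c where "(T ^^ s) (x + 2 ^ s * (2 ^ (L - s) * k)) = (T ^^ s) x + c * (2 ^ (L - s) * k)"
    using T_iterate_add_power2 by blast
  moreover have "2 ^ s * (2 ^ (L - s) * k) = 2 ^ L * k"
    using \<open>s < L\<close> by (simp add: power_add[symmetric] flip: mult.assoc)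
  ultimately have "(T ^^ s) y = (T ^^ s) x + c * (2 ^ (L - s) * k)"
    using k by simp
  with \<open>s < L\<close> show "odd ((T ^^ s) x) \<longleftrightarrow> odd ((T ^^ s) y)" by simp
qed

text \<open>The entry at position \<open>L\<close> supplies one further binary digit: if \<open>y = x + 2 ^ L * k\<close>, the
  \<open>L\<close>-th iterates differ by \<open>c * k\<close> with \<open>c\<close> odd, so equal parity forces \<open>k\<close> to be even.\<close>

lemma cong_if_parity_vector_eq:
  "parity_vector L x = parity_vector L y \<Longrightarrow> [x = y] (mod 2 ^ L)"
proof (induction L)
  case 0
  show ?case by simp
next
  case (Suc L)
  then have "[x = y] (mod 2 ^ L)" by (simp add: parity_vector_eq_iff)
  then obtain k where k: "y = x + 2 ^ L * k"
    by (metis cong_iff_lin mult.commute)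
  obtain c where c: "odd c" "(T ^^ L) y = (T ^^ L) x + c * k"
    using T_iterate_add_power2 k by blast
  moreover have "odd ((T ^^ L) x) \<longleftrightarrow> odd ((T ^^ L) y)"
    using Suc.prems by (simp add: parity_vector_eq_iff)
  ultimately have "even k" by auto
  then show ?case
    using k by (auto simp: cong_iff_lin elim!: evenE)
qed

text \<open>Positions are prescribed one after the other: adding \<open>2 ^ L\<close> keeps the first \<open>L\<close> parities and
  flips the one at position \<open>L\<close>.\<close>

lemma ex_parity_vector:
  "\<exists>x. parity_vector L x = map (\<lambda>s. of_bool (P s)) [0..<L]"
proof (induction L)
  case 0
  show ?case by (simp add: parity_vector_def)
next
  case (Suc L)
  then obtain x where x: "parity_vector L x = map (\<lambda>s. of_bool (P s)) [0..<L]" by blast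
  have append: "parity_vector (Suc L) z = parity_vector L z @ [of_bool (odd ((T ^^ L) z))]" for z
    by (simp add: parity_vector_def)
  obtain c where "odd c" "(T ^^ L) (x + 2 ^ L * 1) = (T ^^ L) x + c * 1"
    using T_iterate_add_power2 by blast
  then have flip: "odd ((T ^^ L) (x + 2 ^ L)) \<longleftrightarrow> \<not> odd ((T ^^ L) x)" by simp
  have same: "parity_vector L (x + 2 ^ L) = parity_vector L x"
    by (rule parity_vector_cong) (simp add: cong_def)
  show ?case
  proof (cases "odd ((T ^^ L) x) \<longleftrightarrow> P L")
    case True
    then show ?thesis using x by (intro exI[of _ x]) (simp add: append)
  next
    case False
    then show ?thesis using x flip same
      by (intro exI[of _ "x + 2 ^ L"]) (simp add: append)
  qed
qed

lemma cong_of_leading_odd_iterates: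
  assumes odds: "\<And>s. s < h \<Longrightarrow> odd ((T ^^ s) x)" and even: "even ((T ^^ h) x)"
  shows "[x = 2 ^ h - 1] (mod 2 ^ (h + 1))"
proof -
  have fixed: "(T ^^ s) (-1) = -1" for s
    by (induction s) (simp_all add: T_def)
  have "parity_vector h (-1) = parity_vector h x"
    using odds by (simp add: parity_vector_eq_iff fixed)
  then obtain k where k: "x = -1 + 2 ^ h * k"
    by (metis cong_if_parity_vector_eq cong_iff_lin mult.commute)
  obtain c where c: "odd c" "(T ^^ h) x = -1 + c * k"
    using T_iterate_add_power2[of h "-1"] k fixed by metis
  with even have "odd k" by auto
  then obtain j where "k = 2 * j + 1" by (auto elim: oddE)
  then have "x = 2 ^ h - 1 + j * 2 ^ (h + 1)"
    using k by (simp add: algebra_simps)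
  then show ?thesis by (simp add: cong_def)
qed

section \<open>The full parity vector and the canonical representative\<close>

lemma kappa_mono: "i \<le> n \<Longrightarrow> kappa i \<le> kappa n"
  unfolding kappa_def by (intro nat_mono floor_mono mult_right_mono) auto

text \<open>Since \<open>log 2 3 \<ge> 1\<close>, there is at least one position after the last possible one.\<close>

lemma kappa_less_sigma: "kappa n + 1 < sigma n"
proof -
  have "real n * log 2 3 + 2 \<le> 1 + real (n + 1) * log 2 3"
    by (simp add: algebra_simps)
  then have "\<lfloor>real n * log 2 3\<rfloor> + 2 \<le> \<lfloor>1 + real (n + 1) * log 2 3\<rfloor>"
    by linarith
  moreover have "0 \<le> \<lfloor>real n * log 2 3\<rfloor>" by simp
  ultimately show ?thesis unfolding kappa_def sigma_def by linarith
qed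

lemma admissible_le_kappa:
  assumes "\<alpha> \<in> admissible n" "a \<in> set \<alpha>"
  shows "a \<le> int (kappa n)"
proof -
  obtain i where i: "i < n + 1" "a = \<alpha> ! i"
    using assms by (auto simp: admissible_def in_set_conv_nth)
  show ?thesis
  proof (cases "i = 0")
    case True
    then show ?thesis using assms i by (simp add: admissible_def)
  next
    case False
    then have "a \<le> int (kappa i)" using assms i by (auto simp: admissible_def)
    also have "\<dots> \<le> int (kappa n)" using i kappa_mono[of i n] by simp
    finally show ?thesis .
  qed
qed

lemma ones_at_sigma:
  assumes "\<alpha> \<in> admissible n"
  shows "ones_at (sigma n) \<alpha> = vec n \<alpha> @ replicate (sigma n - (kappa n + 1)) 0"
proof (rule nth_equalityI)
  show "length (ones_at (sigma n) \<alpha>) = length (vec n \<alpha> @ replicate (sigma n - (kappa n + 1)) 0)"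
    using kappa_less_sigma[of n] by (simp add: ones_at_def vec_def)
next
  fix s assume "s < length (ones_at (sigma n) \<alpha>)"
  then have "s < sigma n" by (simp add: ones_at_def)
  moreover have "int s \<notin> set \<alpha>" if "\<not> s < kappa n + 1"
    using admissible_le_kappa[OF assms, of "int s"] that by auto
  ultimately show "ones_at (sigma n) \<alpha> ! s = (vec n \<alpha> @ replicate (sigma n - (kappa n + 1)) 0) ! s"
    by (auto simp: ones_at_def vec_def nth_append simp del: upt_Suc)
qed

text \<open>All ones lie at positions up to \<open>kappa n\<close>, so the full vector depends on \<open>v\<close> alone and not on
  the choice of \<open>\<alpha>\<close>; this makes the description in the definition proper.\<close>

lemma full_parity_vector_eq_append_zeros:
  assumes "v \<in> VV n"
  shows "full_parity_vector n v = v @ replicate (sigma n - (kappa n + 1)) 0"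
  unfolding full_parity_vector_def
proof (rule the_equality)
  show "\<exists>\<alpha>\<in>admissible n. v = vec n \<alpha> \<and>
      v @ replicate (sigma n - (kappa n + 1)) 0 = ones_at (sigma n) \<alpha>"
    using assms ones_at_sigma by (auto simp: VV_def)
qed (use ones_at_sigma in auto)

lemma full_parity_vector_vec:
  assumes "\<alpha> \<in> admissible n"
  shows "full_parity_vector n (vec n \<alpha>) = ones_at (sigma n) \<alpha>"
  using assms by (simp add: full_parity_vector_eq_append_zeros VV_def ones_at_sigma)

text \<open>The residue \<open>0\<close> is not among the values allowed for the representative; it does not occur,
  because \<open>0\<close> is even while the first entry of the full parity vector is \<open>1\<close>.\<close>

lemma parity_vector_canonical_rep:
  assumes "v \<in> VV n"
  shows "parity_vector (sigma n) (canonical_rep n v) = full_parity_vector n v"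
proof -
  let ?L = "sigma n"
  obtain \<alpha> where \<alpha>: "\<alpha> \<in> admissible n" "v = vec n \<alpha>"
    using assms by (auto simp: VV_def)
  define w where "w = full_parity_vector n v"
  have w: "w = ones_at ?L \<alpha>"
    using \<alpha> by (simp add: w_def full_parity_vector_vec)
  have pos: "0 < ?L" using kappa_less_sigma[of n] by simp
  obtain y where y: "parity_vector ?L y = w"
    unfolding w ones_at_def using ex_parity_vector[of ?L "\<lambda>s. int s \<in> set \<alpha>"] by blast
  define x where "x = y mod 2 ^ ?L"
  have x: "parity_vector ?L x = w"
    using y parity_vector_cong[of x y ?L] by (simp add: x_def cong_def)
  have "0 \<in> set \<alpha>"
    using \<alpha> nth_mem[of 0 \<alpha>] by (simp add: admissible_def)
  then have "w ! 0 = 1" using pos by (simp add: w ones_at_def)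
  with x pos have "odd x" by (auto simp: parity_vector_def split: if_splits)
  then have "x \<noteq> 0" by auto
  moreover have "0 \<le> x" "x < 2 ^ ?L" by (simp_all add: x_def)
  ultimately have range: "x \<in> {1..2 ^ ?L - 1}" by simp
  have "\<exists>!x. x \<in> {1..2 ^ ?L - 1} \<and> parity_vector ?L x = w"
  proof (rule ex1I[of _ x])
    fix z assume z: "z \<in> {1..2 ^ ?L - 1} \<and> parity_vector ?L z = w"
    then have "[z = x] (mod 2 ^ ?L)" using x by (simp add: cong_if_parity_vector_eq)
    then show "z = x" using z range by (simp add: cong_def)
  qed (use x range in simp)
  from theI'[OF this] show ?thesis
    by (simp add: canonical_rep_def w_def)
qed

theorem corollary19:
  fixes n h :: nat and v :: "nat list"
  assumes "n \<ge> 1"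
    and "v \<in> VV n"
    and "leading_ones (full_parity_vector n v) = h"
    and "h \<ge> 2"
  shows "[canonical_rep n v = 2 ^ h - 1] (mod 2 ^ (h + 1))"
proof -
  define w where "w = full_parity_vector n v"
  define x where "x = canonical_rep n v"
  have w: "w = parity_vector (sigma n) x"
    using assms by (simp add: w_def x_def parity_vector_canonical_rep)
  have h: "h = length (takeWhile (\<lambda>b. b = 1) w)"
    using assms by (simp add: w_def leading_ones_def)
  have "0 \<in> set w"
    using assms(2) kappa_less_sigma[of n] by (simp add: w_def full_parity_vector_eq_append_zeros)
  then have "dropWhile (\<lambda>b. b = 1) w \<noteq> []"
    by (auto simp: dropWhile_eq_Nil_conv)
  moreover have "length w = h + length (dropWhile (\<lambda>b. b = 1) w)"
    unfolding h by (metis length_append takeWhile_dropWhile_id)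
  ultimately have less: "h < length w" by simp
  have len: "length w = sigma n" by (simp add: w parity_vector_def)
  have nth: "w ! s = of_bool (odd ((T ^^ s) x))" if "s < sigma n" for s
    using that by (simp add: w parity_vector_def)
  have "odd ((T ^^ s) x)" if "s < h" for s
  proof -
    have "w ! s = 1"
      using that nth_mem[of s "takeWhile (\<lambda>b. b = 1) w"] unfolding h
      by (auto simp: takeWhile_nth dest: set_takeWhileD)
    moreover have "w ! s = of_bool (odd ((T ^^ s) x))"
      using that less len by (intro nth) simp
    ultimately show ?thesis by (metis of_bool_eq_0_iff zero_neq_one)
  qed
  moreover have "even ((T ^^ h) x)"
  proof -
    have "w ! h \<noteq> 1"
      using less unfolding h by (rule nth_length_takeWhile)
    moreover have "w ! h = of_bool (odd ((T ^^ h) x))"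
      using less len by (intro nth) simp
    ultimately show ?thesis by (metis of_bool_eq(2))
  qed
  ultimately show ?thesis
    unfolding x_def by (rule cong_of_leading_odd_iterates)
qed

end
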